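(* There exist constants $c_n>0$ and $c_n'>0$ depending only on $n$ such that the following holds. Let $\mathcal{B}$ be a homothecy invariant basis consisting of convex sets in $\mathbb{R}^n$. For every $\alpha\in(0,1)$, every measurable set $E\subset\mathbb{R}^n$ of finite measure, and every $\delta\in(0,c_n'(1-\alpha)]$, \[ \mathcal{H}_{\mathcal{B},\alpha}(E)\subseteq\mathcal{H}_{\mathcal{B},\,\alpha\left(1+c_n\min(\alpha,1-\alpha)^{2n}\delta\right)}\big(\mathcal{H}_{\mathcal{B},\,1-3n^{3n/2}\delta}(E)\big). \]
   Context: A basis $\mathcal B$ is a collection of bounded open sets in $\mathbb R^n$; it is homothecy invariant if every translate and every positive dilate of a member of $\mathcal B$ belongs to $\mathcal B$. $M_{\mathcal B}f(x)=\sup_{x\in R\in\mathcal B}\frac{1}{|R|}\int_R|f|$ if $x\in\bigcup_{B\in\mathcal B}B$, else $0$. For measurable $E$ and $\beta>0$, $\mathcal H_{\mathcal B,\beta}(E)=\{x\in\mathbb R^n: M_{\mathcal B}\chi_E(x)>\beta\}$. *)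

theory Defs
  imports "HOL-Analysis.Analysis"
begin

definition is_basis :: "'a::euclidean_space set set \<Rightarrow> bool" where
  "is_basis \<B> \<longleftrightarrow> (\<forall>R\<in>\<B>. bounded R \<and> open R)"

definition homothecy_invariant :: "'a::euclidean_space set set \<Rightarrow> bool" where
  "homothecy_invariant \<B> \<longleftrightarrow>
     (\<forall>R\<in>\<B>. (\<forall>v. (\<lambda>y. v + y) ` R \<in> \<B>) \<and> (\<forall>r>0. (\<lambda>y. r *\<^sub>R y) ` R \<in> \<B>))"

definition max_op :: "'a::euclidean_space set set \<Rightarrow> ('a \<Rightarrow> real) \<Rightarrow> 'a \<Rightarrow> real" where
  "max_op \<B> f x =
     (if x \<in> \<Union>\<B>
      then (SUP R\<in>{R\<in>\<B>. x \<in> R}. (1 / measure lebesgue R) * (LINT y:R|lebesgue. \<bar>f y\<bar>))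
      else 0)"

definition halo :: "'a::euclidean_space set set \<Rightarrow> real \<Rightarrow> 'a set \<Rightarrow> 'a set" where
  "halo \<B> \<beta> E = {x. max_op \<B> (indicator E) x > \<beta>}"

end

theory Submission
  imports Defs
begin

text \<open>
  Put \<open>n = DIM('a)\<close>, \<open>K = 3 n powr (3n/2)\<close> and \<open>\<eta> = K\<delta>/2\<close>, and let \<open>R \<in> \<B>\<close> contain \<open>x\<close> with
  \<open>\<bar>E \<inter> R\<bar> > \<alpha>\<bar>R\<bar>\<close>. The set \<open>R\<close> itself witnesses that \<open>x\<close> lies in the iterated halo. If \<open>E\<close> has
  density above \<open>1 - \<eta>\<close> in \<open>R\<close>, then \<open>R\<close> is contained in the inner halo. Otherwise almost every point of
  \<open>E \<inter> R\<close> lies in a small homothet of \<open>R\<close> where \<open>E\<close> has density above \<open>1 - \<eta>\<close>; growing that homothet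
  to \<open>R\<close> we pass through one with density exactly \<open>1 - \<eta>\<close>. Such homothets lie in the inner halo, and a
  Vitali selection yields disjoint ones of total volume at least \<open>8^(-n) \<bar>E \<inter> R\<bar> / 2\<close>, each of which
  adds the proportion \<open>\<eta>\<close> of its volume to \<open>E \<inter> R\<close>. The Vitali constant depends only on \<open>n\<close> because
  \<open>\<bar>R - R\<bar> \<le> 4^n \<bar>R\<bar>\<close>.
\<close>

section \<open>Homothets and difference sets\<close>

definition homothet :: "'a::real_vector \<Rightarrow> real \<Rightarrow> 'a set \<Rightarrow> 'a set" where
  "homothet c t R = (\<lambda>y. c + t *\<^sub>R y) ` R"

lemma mem_homothet_iff:
  assumes "t > 0"
  shows "x \<in> homothet c t R \<longleftrightarrow> (1 / t) *\<^sub>R (x - c) \<in> R"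
proof
  assume "(1 / t) *\<^sub>R (x - c) \<in> R"
  then show "x \<in> homothet c t R"
    unfolding homothet_def using assms by (intro image_eqI[where x = "(1 / t) *\<^sub>R (x - c)"]) auto
qed (use assms in \<open>auto simp: homothet_def\<close>)

lemma measure_homothet:
  fixes R :: "'a::euclidean_space set"
  assumes "t \<ge> 0"
  shows "measure lebesgue (homothet c t R) = t ^ DIM('a) * measure lebesgue R"
  unfolding homothet_def using measure_lebesgue_affine[of t c R] assms by (simp add: add.commute)

lemma open_homothet:
  fixes R :: "'a::euclidean_space set"
  assumes "open R" "t > 0"
  shows "open (homothet c t R)"
proof -
  have "homothet c t R = (+) c ` ((\<lambda>x. t *\<^sub>R x) ` R)"
    unfolding homothet_def by auto
  then show ?thesis
    using assms by (simp add: open_translation open_scaling)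
qed

lemma bounded_homothet:
  fixes R :: "'a::euclidean_space set"
  assumes "bounded R"
  shows "bounded (homothet c t R)"
proof -
  have "homothet c t R = (+) c ` ((\<lambda>x. t *\<^sub>R x) ` R)"
    unfolding homothet_def by auto
  then show ?thesis
    using assms by (simp add: bounded_translation bounded_scaling)
qed

lemma open_differences:
  fixes S T :: "'a::real_normed_vector set"
  assumes "open S"
  shows "open {a - b |a b. a \<in> S \<and> b \<in> T}"
proof -
  have "{a - b |a b. a \<in> S \<and> b \<in> T} = (\<Union>b\<in>T. (\<lambda>a. a - b) ` S)" by auto
  then show ?thesis using assms by (auto intro!: open_UN open_translation_subtract)
qed

lemma bounded_differences:
  fixes S T :: "'a::real_normed_vector set"
  assumes "bounded S" "bounded T"
  shows "bounded {a - b |a b. a \<in> S \<and> b \<in> T}"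
proof -
  have "{a - b |a b. a \<in> S \<and> b \<in> T} = (\<lambda>p. fst p - snd p) ` (S \<times> T)" by force
  then show ?thesis using bounded_minus[OF assms] by (auto simp: case_prod_beta)
qed

section \<open>Preliminaries on Lebesgue measure\<close>

lemma measure_eq_Int_plus_Diff:
  assumes "S \<in> fmeasurable M" "E \<in> sets M"
  shows "measure M S = measure M (E \<inter> S) + measure M (S - E)"
proof -
  have "measure M ((E \<inter> S) \<union> (S - E)) = measure M (E \<inter> S) + measure M (S - E)"
    using fmeasurable_Int_fmeasurable[OF assms] fmeasurable_Diff[OF assms]
    by (intro measure_Un_AE) (auto simp: Int_commute)
  moreover have "(E \<inter> S) \<union> (S - E) = S" by blast
  ultimately show ?thesis by simp
qed

lemma measure_open_pos:
  fixes S :: "'a::euclidean_space set"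
  assumes "open S" "bounded S" "S \<noteq> {}"
  shows "measure lebesgue S > 0"
  using assms lmeasurable_open[of S] open_not_negligible[of S] negligible_iff_measure0
  by (metis zero_less_measure_iff)

text \<open>Fubini is applied over \<open>lborel\<close>, while volumes are real numbers taken for
  \<open>lebesgue\<close>; this passes from one to the other.\<close>

lemma emeasure_lborel_eq_measure_lebesgue:
  assumes "S \<in> sets borel" "S \<in> lmeasurable"
  shows "emeasure lborel S = ennreal (measure lebesgue S)"
proof -
  have "emeasure lborel S = emeasure lebesgue S" using assms(1) by simp
  then show ?thesis using emeasure_eq_measure2[OF assms(2)] by simp
qed

section \<open>Averaging over translates and homothets of high density\<close>

text \<open>Fubini for the function \<open>indicator A x * indicator B (x - y)\<close>: for fixed x
  the reflection taking y to x - y preserves volume. A lower bound on the integrand will bound the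
  difference body of a convex set, and an upper bound will produce homothets of high
  density.\<close>

lemma nn_integral_emeasure_Int_translate:
  fixes A B :: "'a::euclidean_space set"
  assumes [measurable]: "A \<in> sets borel" "B \<in> sets borel"
  shows "(\<integral>\<^sup>+y. emeasure lborel (A \<inter> {x. x - y \<in> B}) \<partial>lborel) = emeasure lborel A * emeasure lborel B"
proof -
  have [measurable]: "{x. x - y \<in> B} \<in> sets borel" for y
  proof -
    have "(\<lambda>x. x - y) -` B \<inter> space borel \<in> sets borel"
      by (rule measurable_sets[OF _ assms(2)]) simp
    then show ?thesis by (simp add: vimage_def)
  qed
  have refl: "(\<integral>\<^sup>+y. indicator B (x - y) \<partial>lborel) = emeasure lborel B" for x
  proof -
    have "(\<lambda>y. x - y) -` B \<inter> space borel \<in> sets borel"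
      by (rule measurable_sets[OF _ assms(2)]) simp
    then have m: "{y. x - y \<in> B} \<in> sets borel" by (simp add: vimage_def)
    have "(\<integral>\<^sup>+y. indicator B (x - y) \<partial>lborel) = (\<integral>\<^sup>+y. indicator {y. x - y \<in> B} y \<partial>lborel)"
      by (intro nn_integral_cong) (simp add: indicator_def)
    also have "\<dots> = emeasure lborel {y. x - y \<in> B}"
      using m by simp
    also have "\<dots> = emeasure lebesgue {y. x - y \<in> B}"
      using m by simp
    also have "{y. x - y \<in> B} = (\<lambda>y. (-1) *\<^sub>R y + x) ` B"
    proof -
      have "y \<in> (\<lambda>y. (-1) *\<^sub>R y + x) ` B" if "x - y \<in> B" for y
        by (rule image_eqI[OF _ that]) simp
      then show ?thesis by auto
    qed
    also have "emeasure lebesgue \<dots> = emeasure lborel B"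
      by (subst emeasure_lebesgue_affine) simp
    finally show ?thesis .
  qed
  have "(\<integral>\<^sup>+y. emeasure lborel (A \<inter> {x. x - y \<in> B}) \<partial>lborel)
      = (\<integral>\<^sup>+y. (\<integral>\<^sup>+x. indicator A x * indicator B (x - y) \<partial>lborel) \<partial>lborel)"
  proof (intro nn_integral_cong)
    fix y :: 'a
    have "(\<integral>\<^sup>+x. indicator A x * indicator B (x - y) \<partial>lborel)
        = (\<integral>\<^sup>+x. indicator (A \<inter> {x. x - y \<in> B}) x \<partial>lborel)"
      by (intro nn_integral_cong) (auto simp: indicator_def)
    then show "emeasure lborel (A \<inter> {x. x - y \<in> B}) = (\<integral>\<^sup>+x. indicator A x * indicator B (x - y) \<partial>lborel)"
      by (simp add: sets.Int)
  qed
  also have "\<dots> = (\<integral>\<^sup>+x. (\<integral>\<^sup>+y. indicator A x * indicator B (x - y) \<partial>lborel) \<partial>lborel)"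
    by (rule lborel_pair.Fubini') measurable
  also have "\<dots> = (\<integral>\<^sup>+x. indicator A x * emeasure lborel B \<partial>lborel)"
    by (intro nn_integral_cong) (simp add: nn_integral_cmult refl)
  also have "\<dots> = emeasure lborel A * emeasure lborel B"
    by (simp add: nn_integral_multc)
  finally show ?thesis .
qed

text \<open>Inner regularity by closed sets gives compact ones here, since the set is bounded.
  Compactness is what later yields a uniform neighbourhood and finite subcovers.\<close>

lemma inner_compact_lebesgue:
  fixes S :: "'a::euclidean_space set"
  assumes "S \<in> sets lebesgue" "bounded S" "e > 0"
  obtains C where "compact C" "C \<subseteq> S" "measure lebesgue S < measure lebesgue C + e"
proof -
  obtain T where T: "closed T" "T \<subseteq> S" "S - T \<in> lmeasurable" "emeasure lebesgue (S - T) < ennreal e"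
    using sets_lebesgue_inner_closed[OF assms(1,3)] by blast
  have c: "compact T" using T assms(2) bounded_subset compact_eq_bounded_closed by blast
  have "measure lebesgue (S - T) < e"
    using T(3,4) assms(3) by (simp add: emeasure_eq_measure2 ennreal_less_iff)
  moreover have "measure lebesgue S = measure lebesgue T + measure lebesgue (S - T)"
  proof -
    have "measure lebesgue (T \<union> (S - T)) = measure lebesgue T + measure lebesgue (S - T)"
      by (rule measure_Un_AE) (use T(3) c lmeasurable_compact in auto)
    moreover have "T \<union> (S - T) = S" using T(2) by auto
    ultimately show ?thesis by simp
  qed
  ultimately show ?thesis using that c T(2) by force
qed

text \<open>Up to translation, the intersection of \<open>R\<close> with its translate by \<open>(a - b) / 2\<close>
  contains \<open>R / 2\<close>; integrate over all translates.\<close>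
lemma difference_body_measure_le:
  fixes R :: "'a::euclidean_space set"
  assumes R: "open R" "bounded R" "convex R" "R \<noteq> {}"
  defines "D \<equiv> {a - b |a b. a \<in> R \<and> b \<in> R}"
  shows "measure lebesgue D \<le> 4 ^ DIM('a) * measure lebesgue R"
proof -
  let ?n = "DIM('a)" and ?m = "measure lebesgue R"
  have oD: "open D" and bD: "bounded D"
    unfolding D_def using R open_differences bounded_differences by blast+
  let ?H = "homothet 0 (1/2) D"
  have oH: "open ?H" and bH: "bounded ?H" using oD bD by (auto intro!: open_homothet bounded_homothet)
  have mR: "R \<in> lmeasurable" "D \<in> lmeasurable" "?H \<in> lmeasurable"
    using R oD bD oH bH lmeasurable_open by auto
  have pos: "?m > 0"
    using R by (intro measure_open_pos)
  have eR: "emeasure lborel R = ennreal ?m" and eH: "emeasure lborel ?H = ennreal (measure lebesgue ?H)"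
    using mR R(1) oH
    by (simp_all add: emeasure_lborel_eq_measure_lebesgue del: measure_completion)
  let ?k = "(1/2) ^ ?n * ?m"
  have key: "ennreal ?k \<le> emeasure lborel (R \<inter> {x. x - y \<in> R})" if "y \<in> ?H" for y
  proof -
    obtain a b where ab: "a \<in> R" "b \<in> R" "y = (1/2) *\<^sub>R (a - b)"
      using \<open>y \<in> ?H\<close> by (auto simp: homothet_def D_def)
    \<comment> \<open>With y = (a - b)/2, the set \<open>?Q\<close> is (a + R)/2, and shifting it by
      -y gives (b + R)/2. Both lie in R by convexity, so the intersection has at least the volume of
      R/2.\<close>
    let ?Q = "homothet ((1/2) *\<^sub>R a) (1/2) R"
    have sub: "?Q \<subseteq> R \<inter> {x. x - y \<in> R}"
    proof
      fix x assume "x \<in> ?Q"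
      then obtain r where r: "r \<in> R" "x = (1/2) *\<^sub>R a + (1/2) *\<^sub>R r" by (auto simp: homothet_def)
      have "x \<in> R" unfolding r(2) using R(3) ab r by (intro convexD) auto
      moreover have "x - y = (1/2) *\<^sub>R b + (1/2) *\<^sub>R r" unfolding r(2) ab(3) by (simp add: algebra_simps)
      moreover have "(1/2) *\<^sub>R b + (1/2) *\<^sub>R r \<in> R" using R(3) ab r by (intro convexD) auto
      ultimately show "x \<in> R \<inter> {x. x - y \<in> R}" by simp
    qed
    have oQ: "open ?Q" "bounded ?Q" using R by (auto intro!: open_homothet bounded_homothet)
    have "ennreal ?k = ennreal (measure lebesgue ?Q)" by (simp add: measure_homothet)
    also have "\<dots> = emeasure lborel ?Q"
      using oQ by (simp add: emeasure_lborel_eq_measure_lebesgue lmeasurable_open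
          del: measure_completion)
    also have "\<dots> \<le> emeasure lborel (R \<inter> {x. x - y \<in> R})"
    proof (rule emeasure_mono[OF sub])
      have "{x. x - y \<in> R} = homothet y 1 R" by (auto simp: mem_homothet_iff)
      then show "R \<inter> {x. x - y \<in> R} \<in> sets lborel" using R(1) by (auto intro!: borel_open open_Int open_homothet)
    qed
    finally show ?thesis .
  qed
  have "ennreal (?k * measure lebesgue ?H) = ennreal ?k * emeasure lborel ?H"
    unfolding eH by (simp add: ennreal_mult)
  also have "\<dots> = (\<integral>\<^sup>+y. ennreal ?k * indicator ?H y \<partial>lborel)"
    using oH by (simp add: nn_integral_cmult_indicator)
  also have "\<dots> \<le> (\<integral>\<^sup>+y. emeasure lborel (R \<inter> {x. x - y \<in> R}) \<partial>lborel)"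
    by (intro nn_integral_mono) (auto simp: indicator_def intro: key)
  also have "\<dots> = ennreal (?m * ?m)"
    using R(1) by (simp add: nn_integral_emeasure_Int_translate eR ennreal_mult)
  finally have "?k * measure lebesgue ?H \<le> ?m * ?m" using ennreal_le_iff by auto
  \<comment> \<open>One factor 2^(-n) is the volume ratio of \<open>?Q\<close> to R; the other comes
    from \<open>?H\<close> being half of D. Together they give 4^(-n).\<close>
  then have "(1/2) ^ ?n * measure lebesgue ?H \<le> ?m" using pos by simp
  then have "(1/4) ^ ?n * measure lebesgue D \<le> ?m"
    by (simp add: measure_homothet power_mult_distrib[symmetric] mult.assoc[symmetric])
  then show ?thesis by (simp add: power_divide field_simps)
qed

text \<open>A substitute for Lebesgue's density theorem: among the translates of a small copy of \<open>R\<close>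
  that meet \<open>F\<close>, one has at least the average density.\<close>
lemma homothet_with_high_density:
  fixes R :: "'a::euclidean_space set"
  assumes R: "open R" "bounded R" "R \<noteq> {}"
    and F: "compact F" "F \<subseteq> R" "measure lebesgue F > 0" and \<eta>: "0 < \<eta>" "\<eta> < 1"
  obtains z s where "s > 0" "homothet z s R \<subseteq> R"
    "measure lebesgue (F \<inter> homothet z s R) > (1 - \<eta>) * measure lebesgue (homothet z s R)"
proof -
  let ?mF = "measure lebesgue F"
  \<comment> \<open>The aim is an open U between F and R, so close to F in measure that F has
    average density above 1 - \<eta> in U.\<close>
  have "?mF < ?mF / (1 - \<eta>)" using F(3) \<eta> by (simp add: field_simps)
  then obtain e where e: "e > 0" "?mF + e < ?mF / (1 - \<eta>)"
    by (metis add.commute diff_gt_0_iff_gt dense less_diff_eq)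
  obtain T where T: "open T" "F \<subseteq> T" "T - F \<in> lmeasurable" "emeasure lebesgue (T - F) < ennreal e"
    using sets_lebesgue_outer_open[OF _ e(1), of F] F(1) lmeasurable_compact by blast
  define U where "U = T \<inter> R"
  have U: "open U" "bounded U" "F \<subseteq> U" "U \<subseteq> R" "U \<in> lmeasurable"
    using T R F lmeasurable_open[of U] by (auto simp: U_def intro: bounded_subset)
  have mF: "F \<in> lmeasurable" using F(1) lmeasurable_compact by blast
  have "measure lebesgue U \<le> measure lebesgue (F \<union> (T - F))"
    by (rule measure_mono_fmeasurable) (use T(3) U mF fmeasurable.Un[OF mF T(3)] in \<open>auto simp: U_def simp del: Un_Diff_cancel\<close>)
  also have "\<dots> \<le> ?mF + measure lebesgue (T - F)"
    using mF T(3) by (intro measure_Un_le) auto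
  also have "measure lebesgue (T - F) < e"
    using T(3,4) e(1) by (simp add: emeasure_eq_measure2 ennreal_less_iff)
  finally have "measure lebesgue U < ?mF / (1 - \<eta>)" using e by simp
  then have mU: "(1 - \<eta>) * measure lebesgue U < ?mF" using \<eta> by (simp add: field_simps)
  obtain \<epsilon> where \<epsilon>: "\<epsilon> > 0" "(\<Union>x\<in>F. ball x \<epsilon>) \<subseteq> U"
    using compact_subset_open_imp_ball_epsilon_subset[OF F(1) U(1,3)] by blast
  obtain b where b: "b > 0" "\<And>x. x \<in> R \<Longrightarrow> norm x \<le> b" using R(2) bounded_pos by blast
  \<comment> \<open>Points of R have norm at most b, so two points of a copy scaled by s are at most
    2bs = \<epsilon>/2 apart. Hence a copy that meets F stays inside U.\<close>
  define s where "s = \<epsilon> / (4 * b)"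
  have s: "s > 0" using b \<epsilon> by (simp add: s_def)
  have near: "homothet z s R \<subseteq> U" if "F \<inter> homothet z s R \<noteq> {}" for z
  proof
    fix w assume "w \<in> homothet z s R"
    then obtain r where r: "r \<in> R" "w = z + s *\<^sub>R r" by (auto simp: homothet_def)
    from that obtain q where q: "q \<in> R" "z + s *\<^sub>R q \<in> F" by (auto simp: homothet_def)
    have "dist (z + s *\<^sub>R q) w = s * norm (q - r)"
      using s by (simp add: r dist_norm scaleR_right_diff_distrib[symmetric])
    also have "\<dots> \<le> s * (2 * b)"
      using b(2)[OF r(1)] b(2)[OF q(1)] norm_triangle_ineq4[of q r] s by (intro mult_left_mono) auto
    also have "\<dots> < \<epsilon>" using b \<epsilon> by (simp add: s_def)
    finally have "w \<in> ball (z + s *\<^sub>R q) \<epsilon>" by simp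
    then show "w \<in> U" using \<epsilon>(2) q(2) by blast
  qed
  obtain r0 where r0: "r0 \<in> R" using R(3) by blast
  \<comment> \<open>\<open>?V\<close> is the set of y with y + s r0 in U. It has the volume of U and
    contains every y for which \<open>homothet y s R\<close> lies in U, in particular every y for
    which that copy meets F.\<close>
  let ?V = "homothet (- (s *\<^sub>R r0)) 1 U"
  have oV: "open ?V" "bounded ?V" using U by (auto intro!: open_homothet bounded_homothet)
  have mV: "measure lebesgue ?V = measure lebesgue U" by (simp add: measure_homothet)
  let ?B = "homothet 0 s R"
  have B: "open ?B" "bounded ?B" using R s by (auto intro!: open_homothet bounded_homothet)
  have tr: "{x. x - y \<in> ?B} = homothet y s R" for y
    using s by (auto simp: mem_homothet_iff)
  have mB: "measure lebesgue (homothet y s R) = measure lebesgue ?B" for y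
    using s by (simp add: measure_homothet)
  show thesis
  proof (rule ccontr)
    \<comment> \<open>If all these copies had density at most 1 - \<eta>, integrating over y in
      \<open>?V\<close> would give |F||B| \<le> (1 - \<eta>)|U||B|, against
      \<open>mU\<close>.\<close>
    assume "\<not> thesis"
    then have 0: "\<not> (s > 0 \<and> homothet z s R \<subseteq> R \<and>
        measure lebesgue (F \<inter> homothet z s R) > (1 - \<eta>) * measure lebesgue (homothet z s R))" for z s
      using that by blast
    have no: "measure lebesgue (F \<inter> homothet y s R) \<le> (1 - \<eta>) * measure lebesgue ?B"
      if "homothet y s R \<subseteq> R" for y
      using that s 0 mB by (metis not_le)
    let ?k = "(1 - \<eta>) * measure lebesgue ?B"
    have key: "emeasure lborel (F \<inter> {x. x - y \<in> ?B}) \<le> ennreal ?k * indicator ?V y" for y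
    proof (cases "F \<inter> homothet y s R = {}")
      case False
      then have sub: "homothet y s R \<subseteq> U" by (rule near)
      then have "y + s *\<^sub>R r0 \<in> U" using r0 by (auto simp: homothet_def)
      then have yV: "y \<in> ?V" by (simp add: mem_homothet_iff)
      have o: "open (homothet y s R)" using R s by (auto intro!: open_homothet)
      have "emeasure lborel (F \<inter> homothet y s R) = ennreal (measure lebesgue (F \<inter> homothet y s R))"
        by (rule emeasure_lborel_eq_measure_lebesgue)
          (use mF F(1) o in \<open>auto intro!: fmeasurable_Int_fmeasurable sets.Int[OF borel_compact borel_open]\<close>)
      also have "\<dots> \<le> ennreal ?k" using no sub U(4) by (intro ennreal_leI) auto
      finally show ?thesis using yV by (simp add: tr)
    qed (simp add: tr)
    have "ennreal (?mF * measure lebesgue ?B) = emeasure lborel F * emeasure lborel ?B"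
      using mF B F(1)
      by (simp add: ennreal_mult emeasure_lborel_eq_measure_lebesgue lmeasurable_open borel_compact
          del: measure_completion)
    also have "\<dots> = (\<integral>\<^sup>+y. emeasure lborel (F \<inter> {x. x - y \<in> ?B}) \<partial>lborel)"
      using F(1) B(1) by (simp add: nn_integral_emeasure_Int_translate borel_compact)
    also have "\<dots> \<le> (\<integral>\<^sup>+y. ennreal ?k * indicator ?V y \<partial>lborel)"
      by (intro nn_integral_mono key)
    also have "\<dots> = ennreal ?k * emeasure lborel ?V"
      using oV by (simp add: nn_integral_cmult_indicator)
    also have "\<dots> = ennreal (?k * measure lebesgue U)"
      using oV \<eta>
      by (simp add: ennreal_mult emeasure_lborel_eq_measure_lebesgue lmeasurable_open mV[symmetric]
          del: measure_completion)
    finally have "?mF * measure lebesgue ?B \<le> ((1 - \<eta>) * measure lebesgue U) * measure lebesgue ?B"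
      using \<eta> by (simp add: ennreal_le_iff mult_ac)
    moreover have "measure lebesgue ?B > 0"
      using B R(3) by (intro measure_open_pos) (auto simp: homothet_def)
    ultimately show False using mU by simp
  qed
qed

text \<open>The homothets \<open>(1 - u) Q + u R\<close> increase from \<open>Q\<close> to \<open>R\<close> as \<open>u\<close> runs through \<open>[0, 1]\<close>,
  so that the measure of their intersection with \<open>E\<close> is at least as continuous as their volume.\<close>
lemma homothet_with_exact_density:
  fixes R E :: "'a::euclidean_space set"
  assumes R: "open R" "bounded R" "convex R" and E: "E \<in> sets lebesgue"
    and s: "s > 0" "homothet z s R \<subseteq> R"
    and dens: "measure lebesgue (E \<inter> homothet z s R) \<ge> \<theta> * measure lebesgue (homothet z s R)"
      "measure lebesgue (E \<inter> R) \<le> \<theta> * measure lebesgue R"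
  obtains c t where "t > 0" "homothet z s R \<subseteq> homothet c t R" "homothet c t R \<subseteq> R"
    "measure lebesgue (E \<inter> homothet c t R) = \<theta> * measure lebesgue (homothet c t R)"
proof -
  \<comment> \<open>With Q = z + sR, convexity turns the Minkowski sum (1 - u)Q + uR into the single
    homothet (1 - u)z + ((1 - u)s + u)R, whose ratio is \<open>l u\<close>.\<close>
  define l where "l u = (1 - u) * s + u" for u
  define Q where "Q u = homothet ((1 - u) *\<^sub>R z) (l u) R" for u
  have lpos: "l u > 0" if "0 \<le> u" "u \<le> 1" for u
  proof (cases "u = 1")
    case False
    then have "(1 - u) * s > 0" using that s by simp
    then show ?thesis using that by (simp add: l_def)
  qed (simp add: l_def)
  have mono: "Q u \<subseteq> Q v" if uv: "0 \<le> u" "u \<le> v" "v \<le> 1" for u v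
  proof
    fix x assume "x \<in> Q u"
    then obtain r where r: "r \<in> R" "x = (1 - u) *\<^sub>R z + l u *\<^sub>R r" by (auto simp: Q_def homothet_def)
    have lv: "l v > 0" using lpos uv by simp
    \<comment> \<open>The weights solve l(v)(a(z + sr) + br) = (v - u)z + l(u)r. The point of Q(u)
      with parameter r thus becomes the point of Q(v) whose parameter is a convex combination of z +
      sr and r, both in R.\<close>
    define a where "a = (v - u) / l v"
    define b where "b = (s * (1 - v) + u) / l v"
    have ab: "a \<ge> 0" "b \<ge> 0" using uv s lv by (simp_all add: a_def b_def)
    have "a + b = 1" using lv by (simp add: a_def b_def add_divide_distrib[symmetric]) (simp add: l_def algebra_simps)
    have "z + s *\<^sub>R r \<in> R" using s(2) r(1) by (auto simp: homothet_def)
    then have "a *\<^sub>R (z + s *\<^sub>R r) + b *\<^sub>R r \<in> R"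
      using R(3) r(1) ab \<open>a + b = 1\<close> by (intro convexD) auto
    moreover have "x = (1 - v) *\<^sub>R z + l v *\<^sub>R (a *\<^sub>R (z + s *\<^sub>R r) + b *\<^sub>R r)"
    proof -
      have "l v * a = v - u" "l v * b = s * (1 - v) + u" using lv by (simp_all add: a_def b_def)
      then have "l v *\<^sub>R (a *\<^sub>R (z + s *\<^sub>R r) + b *\<^sub>R r) = (v - u) *\<^sub>R (z + s *\<^sub>R r) + (s * (1 - v) + u) *\<^sub>R r"
        by (simp add: scaleR_add_right)
      then show ?thesis by (simp add: r(2) l_def algebra_simps)
    qed
    ultimately show "x \<in> Q v" by (auto simp: Q_def homothet_def)
  qed
  have oQ: "open (Q u)" "bounded (Q u)" "Q u \<in> lmeasurable" "E \<inter> Q u \<in> lmeasurable"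
    if "0 \<le> u" "u \<le> 1" for u
  proof -
    show "open (Q u)" "bounded (Q u)" using R lpos[OF that] by (auto simp: Q_def open_homothet bounded_homothet)
    then show m: "Q u \<in> lmeasurable" by (simp add: lmeasurable_open)
    show "E \<inter> Q u \<in> lmeasurable" using fmeasurable_Int_fmeasurable[OF m E] by (simp add: Int_commute)
  qed
  define f where "f u = measure lebesgue (E \<inter> Q u)" for u
  define g where "g u = measure lebesgue (Q u)" for u
  have geq: "g u = l u ^ DIM('a) * measure lebesgue R" if "0 \<le> u" "u \<le> 1" for u
    using lpos[OF that] by (simp add: g_def Q_def measure_homothet)
  have diff: "f u \<le> f v \<and> f v - f u \<le> g v - g u" if uv: "0 \<le> u" "u \<le> v" "v \<le> 1" for u v
  proof
    show "f u \<le> f v" unfolding f_def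
      by (rule measure_mono_fmeasurable) (use mono[OF uv] oQ uv in auto)
    have m: "E \<inter> Q u \<in> lmeasurable" "Q v - Q u \<in> lmeasurable"
      using oQ uv by (auto intro!: fmeasurable_Diff)
    have "f v \<le> measure lebesgue ((E \<inter> Q u) \<union> (Q v - Q u))" unfolding f_def
      by (rule measure_mono_fmeasurable) (use oQ[of v] uv m fmeasurable.Un[OF m] in auto)
    also have "\<dots> \<le> f u + measure lebesgue (Q v - Q u)" unfolding f_def
      by (rule measure_Un_le) (use m in auto)
    also have "measure lebesgue (Q v - Q u) = g v - g u" unfolding g_def
      by (rule measurable_measure_Diff) (use mono[OF uv] oQ uv in auto)
    finally show "f v - f u \<le> g v - g u" by simp
  qed
  have absd: "\<bar>f u - f v\<bar> \<le> \<bar>g u - g v\<bar>" if "u \<in> {0..1}" "v \<in> {0..1}" for u v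
    using diff[of u v] diff[of v u] that by (cases "u \<le> v") auto
  have cg: "continuous_on {0..1} g"
  proof (rule continuous_on_eq)
    show "continuous_on {0..1} (\<lambda>u. l u ^ DIM('a) * measure lebesgue R)"
      unfolding l_def by (intro continuous_intros)
  qed (simp add: geq)
  have "continuous_on {0..1} f"
    using cg unfolding continuous_on_iff dist_real_def by (meson absd order.strict_trans1)
  then have "continuous_on {0..1} (\<lambda>u. f u - \<theta> * g u)" using cg by (intro continuous_intros)
  moreover have Q01: "Q 0 = homothet z s R" "Q 1 = R" by (simp_all add: Q_def l_def homothet_def)
  ultimately obtain u where u: "0 \<le> u" "u \<le> 1" "f u - \<theta> * g u = 0"
    using IVT2'[of "\<lambda>u. f u - \<theta> * g u" 1 0 0] dens by (auto simp: f_def g_def)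
  show thesis
  proof (rule that)
    show "l u > 0" using lpos u by simp
    show "homothet z s R \<subseteq> homothet ((1 - u) *\<^sub>R z) (l u) R"
      using mono[of 0 u] u Q01(1) by (simp add: Q_def)
    show "homothet ((1 - u) *\<^sub>R z) (l u) R \<subseteq> R"
      using mono[of u 1] u Q01(2) by (simp add: Q_def)
  qed (use u in \<open>simp add: f_def g_def Q_def\<close>)
qed

section \<open>Vitali selection among homothets of one convex set\<close>

text \<open>Greedy selection: the induction adds indices in order of decreasing t. A new set either
  meets a chosen one, whose t is at least as large, or is chosen itself.\<close>

lemma finite_Vitali_selection:
  fixes t :: "'i \<Rightarrow> real" and Q :: "'i \<Rightarrow> 'b set"
  assumes "finite I"
  shows "\<exists>J\<subseteq>I. disjoint_family_on Q J \<and> (\<forall>i\<in>I. Q i \<noteq> {} \<longrightarrow> (\<exists>j\<in>J. Q i \<inter> Q j \<noteq> {} \<and> t i \<le> t j))"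
  using assms
proof (induction I rule: finite_ranking_induct[where f = "\<lambda>i. - t i"])
  case (insert x I)
  then obtain J where J: "J \<subseteq> I" "disjoint_family_on Q J"
    "\<forall>i\<in>I. Q i \<noteq> {} \<longrightarrow> (\<exists>j\<in>J. Q i \<inter> Q j \<noteq> {} \<and> t i \<le> t j)" by blast
  show ?case
  proof (cases "\<exists>j\<in>J. Q x \<inter> Q j \<noteq> {}")
    case True
    then obtain j where j: "j \<in> J" "Q x \<inter> Q j \<noteq> {}" by blast
    then have "t x \<le> t j" using insert(2)[of j] J(1) by auto
    with J j show ?thesis by (intro exI[of _ J]) auto
  next
    case False
    then have "disjoint_family_on Q (insert x J)"
      using J(2) unfolding disjoint_family_on_def by (auto simp: Int_commute)
    with J(1,3) show ?thesis by (intro exI[of _ "insert x J"]) auto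
  qed
qed (simp add: disjoint_family_on_def)

text \<open>Let p and q be the parameters of a common point and k = t/t'. A point with parameter r
  equals c' + t'(q + u - p), where u = (1 - k)p + kr lies in R. Adding and subtracting
  \<open>r0\<close> writes q + u - p as r0 plus twice a difference of two midpoints in R. Thus R - R
  replaces the usual concentric enlargement, whatever the position of the origin.\<close>

lemma homothet_subset_enlargement:
  fixes R :: "'a::real_vector set"
  assumes "convex R" and t: "0 < t" "t \<le> t'" and meet: "homothet c t R \<inter> homothet c' t' R \<noteq> {}"
    and r0: "r0 \<in> R"
  shows "homothet c t R \<subseteq> homothet (c' + t' *\<^sub>R r0) (2 * t') {a - b |a b. a \<in> R \<and> b \<in> R}"
proof
  fix w assume "w \<in> homothet c t R"
  then obtain r where r: "r \<in> R" "w = c + t *\<^sub>R r" by (auto simp: homothet_def)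
  from meet obtain p q where pq: "p \<in> R" "q \<in> R" "c + t *\<^sub>R p = c' + t' *\<^sub>R q" by (auto simp: homothet_def)
  define k where "k = t / t'"
  have k: "0 \<le> k" "k \<le> 1" "t' * k = t" using t by (simp_all add: k_def)
  have u: "(1 - k) *\<^sub>R p + k *\<^sub>R r \<in> R" using assms(1) k pq r by (intro convexD) auto
  have a: "(1/2) *\<^sub>R ((1 - k) *\<^sub>R p + k *\<^sub>R r) + (1/2) *\<^sub>R q \<in> R"
    by (rule convexD[OF assms(1) u pq(2)]) auto
  have b: "(1/2) *\<^sub>R p + (1/2) *\<^sub>R r0 \<in> R" using assms(1) pq r0 by (intro convexD) auto
  have "w = c' + t' *\<^sub>R q - t *\<^sub>R p + t *\<^sub>R r" using pq(3) r(2) by (simp add: algebra_simps)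
  also have "\<dots> = (c' + t' *\<^sub>R r0) + (2 * t') *\<^sub>R
      (((1/2) *\<^sub>R ((1 - k) *\<^sub>R p + k *\<^sub>R r) + (1/2) *\<^sub>R q) - ((1/2) *\<^sub>R p + (1/2) *\<^sub>R r0))"
    by (simp add: algebra_simps k(3)[symmetric])
  finally show "w \<in> homothet (c' + t' *\<^sub>R r0) (2 * t') {a - b |a b. a \<in> R \<and> b \<in> R}"
    using a b unfolding homothet_def by blast
qed

text \<open>The enlarged sets of the selected homothets cover C. The constant is 8^n = 2^n 4^n:
  enlargement by 2, and the bound 4^n for the difference body. It does not depend on the shape of
  R.\<close>

lemma homothets_Vitali_covering:
  fixes R :: "'a::euclidean_space set"
  assumes R: "open R" "bounded R" "convex R" and I: "finite I" "\<And>i. i \<in> I \<Longrightarrow> t i > 0"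
    and C: "C \<in> sets lebesgue" "C \<subseteq> (\<Union>i\<in>I. homothet (c i) (t i) R)"
  obtains J where "J \<subseteq> I" "disjoint_family_on (\<lambda>i. homothet (c i) (t i) R) J"
    "measure lebesgue C \<le> 8 ^ DIM('a) * (\<Sum>j\<in>J. measure lebesgue (homothet (c j) (t j) R))"
proof (cases "R = {}")
  case True
  then have "C = {}" using C(2) by (simp add: homothet_def)
  then show thesis using that[of "{}"] by (simp add: disjoint_family_on_def)
next
  case False
  then obtain r0 where r0: "r0 \<in> R" by blast
  let ?Q = "\<lambda>i. homothet (c i) (t i) R"
  let ?D = "{a - b |a b. a \<in> R \<and> b \<in> R}"
  let ?L = "\<lambda>j. homothet (c j + t j *\<^sub>R r0) (2 * t j) ?D"
  obtain J where J: "J \<subseteq> I" "disjoint_family_on ?Q J"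
    "\<forall>i\<in>I. ?Q i \<noteq> {} \<longrightarrow> (\<exists>j\<in>J. ?Q i \<inter> ?Q j \<noteq> {} \<and> t i \<le> t j)"
    using finite_Vitali_selection[OF I(1), of ?Q t] by blast
  have fJ: "finite J" using J(1) I(1) finite_subset by blast
  have sub: "C \<subseteq> (\<Union>j\<in>J. ?L j)"
  proof
    fix x assume "x \<in> C"
    then obtain i where i: "i \<in> I" "x \<in> ?Q i" using C(2) by blast
    then obtain j where "j \<in> J" "?Q i \<inter> ?Q j \<noteq> {}" "t i \<le> t j" using J(3) by blast
    then show "x \<in> (\<Union>j\<in>J. ?L j)"
      using homothet_subset_enlargement[OF R(3) I(2)[OF i(1)] _ _ r0] i(2) by blast
  qed
  have oD: "open ?D" and bD: "bounded ?D"
    using R open_differences bounded_differences by blast+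
  have tJ: "t j > 0" if "j \<in> J" for j using that J(1) I(2) by blast
  have mL: "?L j \<in> lmeasurable" if "j \<in> J" for j
    using tJ[OF that] oD bD by (intro lmeasurable_open open_homothet bounded_homothet) auto
  have "measure lebesgue C \<le> measure lebesgue (\<Union>j\<in>J. ?L j)"
    by (rule measure_mono_fmeasurable[OF sub C(1)]) (use fJ mL in auto)
  also have "\<dots> \<le> (\<Sum>j\<in>J. measure lebesgue (?L j))"
    using fJ mL by (intro measure_UNION_le) auto
  also have "\<dots> \<le> (\<Sum>j\<in>J. 8 ^ DIM('a) * measure lebesgue (?Q j))"
  proof (rule sum_mono)
    fix j assume "j \<in> J"
    have "measure lebesgue (?L j) = (2 * t j) ^ DIM('a) * measure lebesgue ?D"
      using tJ[OF \<open>j \<in> J\<close>] by (simp add: measure_homothet)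
    also have "\<dots> \<le> (2 * t j) ^ DIM('a) * (4 ^ DIM('a) * measure lebesgue R)"
      using tJ[OF \<open>j \<in> J\<close>] difference_body_measure_le[OF R False] by (intro mult_left_mono) auto
    also have "\<dots> = (8 * t j) ^ DIM('a) * measure lebesgue R"
    proof -
      have "(8::real) ^ DIM('a) = 2 ^ DIM('a) * 4 ^ DIM('a)" by (simp flip: power_mult_distrib)
      then show ?thesis by (simp add: power_mult_distrib)
    qed
    also have "\<dots> = 8 ^ DIM('a) * measure lebesgue (?Q j)"
      using tJ[OF \<open>j \<in> J\<close>] by (simp add: measure_homothet power_mult_distrib)
    finally show "measure lebesgue (?L j) \<le> 8 ^ DIM('a) * measure lebesgue (?Q j)" .
  qed
  also have "\<dots> = 8 ^ DIM('a) * (\<Sum>j\<in>J. measure lebesgue (?Q j))" by (simp add: sum_distrib_left)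
  finally show thesis using that J by blast
qed

section \<open>Gain of measure inside one basis set\<close>

text \<open>W contains almost all of E \<inter> R, and each homothet forming W misses E in exactly
  the proportion \<eta>. Disjoint ones selected by the covering lemma therefore add at least
  \<eta>|E \<inter> R|/(2 * 8^n) outside E.\<close>

lemma homothets_gain:
  fixes R E :: "'a::euclidean_space set"
  assumes R: "open R" "bounded R" "convex R" and E: "E \<in> sets lebesgue" and \<eta>: "0 < \<eta>" "\<eta> < 1"
    and dens: "measure lebesgue (E \<inter> R) \<le> (1 - \<eta>) * measure lebesgue R"
  defines "W \<equiv> \<Union>{homothet c t R |c t. t > 0 \<and> homothet c t R \<subseteq> R \<and>
    measure lebesgue (E \<inter> homothet c t R) = (1 - \<eta>) * measure lebesgue (homothet c t R)}"
  shows "(1 + \<eta> / (2 * 8 ^ DIM('a))) * measure lebesgue (E \<inter> R) \<le> measure lebesgue W"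
proof (cases "measure lebesgue (E \<inter> R) = 0")
  case False
  define m where "m = measure lebesgue (E \<inter> R)"
  have m: "m > 0" using False by (simp add: m_def zero_less_measure_iff)
  have R0: "R \<noteq> {}" using False by auto
  define P where "P = {p. snd p > 0 \<and> homothet (fst p) (snd p) R \<subseteq> R \<and>
    measure lebesgue (E \<inter> homothet (fst p) (snd p) R) = (1 - \<eta>) * measure lebesgue (homothet (fst p) (snd p) R)}"
  let ?Q = "\<lambda>p. homothet (fst p) (snd p) R"
  have W: "W = (\<Union>p\<in>P. ?Q p)" unfolding W_def P_def by fastforce
  have oQ: "open (?Q p)" "bounded (?Q p)" if "p \<in> P" for p
    using that R by (auto simp: P_def intro: open_homothet bounded_homothet)
  have oW: "open W" unfolding W using oQ by blast
  have WR: "W \<subseteq> R" unfolding W P_def by auto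
  have mea: "W \<in> lmeasurable" using oW WR R(2) by (meson bounded_subset lmeasurable_open)
  have mQ: "?Q p \<in> lmeasurable" if "p \<in> P" for p using oQ[OF that] by (simp add: lmeasurable_open)
  have EW: "E \<inter> W \<in> lmeasurable" "W - E \<in> lmeasurable"
    using fmeasurable_Int_fmeasurable[OF mea E] fmeasurable_Diff[OF mea E] by (simp_all add: Int_commute)
  have ER: "E \<inter> R \<in> lmeasurable"
    using fmeasurable_Int_fmeasurable[OF lmeasurable_open[OF R(2,1)] E] by (simp add: Int_commute)
  \<comment> \<open>Otherwise a compact C of positive measure in E \<inter> R - W would be dense in
    some small homothet. Growing that homothet to density exactly 1 - \<eta> puts it inside W, hence
    away from C.\<close>
  have null: "measure lebesgue (E \<inter> R - W) = 0"
  proof (rule ccontr)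
    assume "measure lebesgue (E \<inter> R - W) \<noteq> 0"
    then have p: "measure lebesgue (E \<inter> R - W) > 0" by (simp add: zero_less_measure_iff)
    obtain C where C: "compact C" "C \<subseteq> E \<inter> R - W" "measure lebesgue C > 0"
    proof (rule inner_compact_lebesgue[OF _ _ p])
      show "E \<inter> R - W \<in> sets lebesgue" using ER mea by auto
      show "bounded (E \<inter> R - W)" using R(2) by (rule bounded_subset) auto
    qed auto
    then obtain z s where zs: "s > 0" "homothet z s R \<subseteq> R"
      "measure lebesgue (C \<inter> homothet z s R) > (1 - \<eta>) * measure lebesgue (homothet z s R)"
      using homothet_with_high_density[OF R(1,2) R0 C(1) _ C(3) \<eta>] by blast
    have mz: "homothet z s R \<in> lmeasurable"
      using zs R by (intro lmeasurable_open open_homothet bounded_homothet)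
    have "measure lebesgue (C \<inter> homothet z s R) \<le> measure lebesgue (E \<inter> homothet z s R)"
    proof (rule measure_mono_fmeasurable)
      show "C \<inter> homothet z s R \<in> sets lebesgue"
        using lmeasurable_compact[OF C(1)] mz by auto
      show "E \<inter> homothet z s R \<in> lmeasurable"
        using fmeasurable_Int_fmeasurable[OF mz E] by (simp add: Int_commute)
    qed (use C(2) in auto)
    then have h: "(1 - \<eta>) * measure lebesgue (homothet z s R) \<le> measure lebesgue (E \<inter> homothet z s R)"
      using zs(3) by simp
    obtain c t where "t > 0" "homothet z s R \<subseteq> homothet c t R" "homothet c t R \<subseteq> R"
      "measure lebesgue (E \<inter> homothet c t R) = (1 - \<eta>) * measure lebesgue (homothet c t R)"
      by (rule homothet_with_exact_density[OF R E zs(1,2) h dens])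
    then have "homothet z s R \<subseteq> W" unfolding W_def by blast
    then have "C \<inter> homothet z s R = {}" using C(2) by blast
    then show False using zs(3) \<eta> by (simp add: mult_less_0_iff not_less)
  qed
  have mEW: "m \<le> measure lebesgue (E \<inter> W)"
  proof -
    have "m \<le> measure lebesgue ((E \<inter> W) \<union> (E \<inter> R - W))" unfolding m_def
      by (rule measure_mono_fmeasurable) (use ER EW(1) mea in \<open>auto intro!: fmeasurable.Un fmeasurable.Diff\<close>)
    also have "\<dots> \<le> measure lebesgue (E \<inter> W) + measure lebesgue (E \<inter> R - W)"
      by (rule measure_Un_le) (use ER EW(1) mea in auto)
    finally show ?thesis using null by simp
  qed
  \<comment> \<open>Passing to a compact set allows a finite subcover by the open homothets. Keeping
    only more than half of the measure is the source of the factor 2 beside 8^n.\<close>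
  obtain C where C: "compact C" "C \<subseteq> E \<inter> W" "measure lebesgue (E \<inter> W) < measure lebesgue C + m / 2"
  proof (rule inner_compact_lebesgue)
    show "E \<inter> W \<in> sets lebesgue" using EW by auto
    show "bounded (E \<inter> W)" using R(2) WR by (meson bounded_subset inf_le2)
    show "m / 2 > 0" using m by simp
  qed
  have "C \<subseteq> (\<Union>p\<in>P. ?Q p)" using C(2) W by blast
  then obtain I where I: "I \<subseteq> P" "finite I" "C \<subseteq> (\<Union>p\<in>I. ?Q p)"
    using compactE_image[OF C(1), of P ?Q] oQ by metis
  have It: "snd p > 0" if "p \<in> I" for p using that I(1) by (auto simp: P_def)
  obtain J where J: "J \<subseteq> I" "disjoint_family_on ?Q J"
    "measure lebesgue C \<le> 8 ^ DIM('a) * (\<Sum>j\<in>J. measure lebesgue (?Q j))"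
    by (rule homothets_Vitali_covering[OF R I(2) It fmeasurableD[OF lmeasurable_compact[OF C(1)]] I(3)])
  have fJ: "finite J" "J \<subseteq> P" using J(1) I finite_subset by auto
  have mQE: "?Q j - E \<in> lmeasurable" if "j \<in> J" for j
    using fmeasurable_Diff[OF mQ E] that fJ(2) by blast
  \<comment> \<open>Exact density is used here: density merely above 1 - \<eta> would give no lower
    bound on the part outside E.\<close>
  have "\<eta> * (\<Sum>j\<in>J. measure lebesgue (?Q j)) = (\<Sum>j\<in>J. measure lebesgue (?Q j - E))"
    unfolding sum_distrib_left
  proof (rule sum.cong)
    fix j assume "j \<in> J"
    then have j: "j \<in> P" using fJ by blast
    have "measure lebesgue (?Q j - E) = measure lebesgue (?Q j) - measure lebesgue (E \<inter> ?Q j)"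
      using measure_eq_Int_plus_Diff[OF mQ[OF j] E] by simp
    then show "\<eta> * measure lebesgue (?Q j) = measure lebesgue (?Q j - E)"
      using j by (simp add: P_def algebra_simps)
  qed simp
  also have "\<dots> = measure lebesgue (\<Union>j\<in>J. ?Q j - E)"
  proof (rule measure_UNION'[symmetric])
    show "pairwise (\<lambda>i j. disjnt (?Q i - E) (?Q j - E)) J"
      using J(2) unfolding pairwise_def disjnt_def disjoint_family_on_def by blast
  qed (use fJ(1) mQE in auto)
  also have "\<dots> \<le> measure lebesgue (W - E)"
  proof (rule measure_mono_fmeasurable)
    show "(\<Union>j\<in>J. ?Q j - E) \<in> sets lebesgue"
      by (rule sets.finite_UN[OF fJ(1) fmeasurableD[OF mQE]])
    show "(\<Union>j\<in>J. ?Q j - E) \<subseteq> W - E" using fJ(2) W by blast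
  qed (rule EW(2))
  finally have gain: "\<eta> * (\<Sum>j\<in>J. measure lebesgue (?Q j)) \<le> measure lebesgue (W - E)" .
  have "m / 2 \<le> 8 ^ DIM('a) * (\<Sum>j\<in>J. measure lebesgue (?Q j))"
    using C(3) J(3) mEW by simp
  then have "\<eta> * (m / 2) \<le> \<eta> * (8 ^ DIM('a) * (\<Sum>j\<in>J. measure lebesgue (?Q j)))"
    using \<eta>(1) by (intro mult_left_mono) auto
  also have "\<dots> = 8 ^ DIM('a) * (\<eta> * (\<Sum>j\<in>J. measure lebesgue (?Q j)))" by (rule mult.left_commute)
  also have "\<dots> \<le> 8 ^ DIM('a) * measure lebesgue (W - E)" using gain by (intro mult_left_mono) auto
  finally have "\<eta> * (m / 2) \<le> 8 ^ DIM('a) * measure lebesgue (W - E)" .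
  then have "\<eta> / (2 * 8 ^ DIM('a)) * m \<le> measure lebesgue (W - E)"
    by (simp add: field_simps)
  moreover have "measure lebesgue W = measure lebesgue (E \<inter> W) + measure lebesgue (W - E)"
    by (rule measure_eq_Int_plus_Diff[OF mea E])
  ultimately show ?thesis using mEW by (simp add: m_def algebra_simps)
qed simp

section \<open>Halos and their iteration\<close>

lemma indicator_average:
  fixes E R :: "'a::euclidean_space set"
  shows "(1 / measure lebesgue R) * (LINT y:R|lebesgue. \<bar>indicator E y :: real\<bar>)
    = measure lebesgue (E \<inter> R) / measure lebesgue R"
proof -
  have "(LINT y:R|lebesgue. \<bar>indicator E y :: real\<bar>) = (LINT y|lebesgue. indicator (E \<inter> R) y)"
    unfolding set_lebesgue_integral_def by (intro Bochner_Integration.integral_cong) (auto simp: indicator_def)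
  then show ?thesis by simp
qed

lemma average_le_1:
  fixes E R :: "'a::euclidean_space set"
  assumes "E \<in> sets lebesgue" "open R" "bounded R"
  shows "measure lebesgue (E \<inter> R) / measure lebesgue R \<le> 1"
proof -
  have R: "R \<in> lmeasurable" using assms by (simp add: lmeasurable_open)
  have "measure lebesgue (E \<inter> R) \<le> measure lebesgue R"
    by (rule measure_mono_fmeasurable) (use R assms in auto)
  then show ?thesis by (simp add: divide_le_eq_1 zero_less_measure_iff)
qed

text \<open>Averages of an indicator are at most 1, so the supremum is a genuine one and exceeds
  \<beta> only if some average does. Off the union of the basis the operator has the default value
  0, which \<beta> \<ge> 0 keeps out of the halo.\<close>

lemma mem_halo_iff:
  assumes "is_basis \<B>" "E \<in> sets lebesgue" "\<beta> \<ge> 0"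
  shows "x \<in> halo \<B> \<beta> E \<longleftrightarrow>
    (\<exists>R\<in>\<B>. x \<in> R \<and> \<beta> < measure lebesgue (E \<inter> R) / measure lebesgue R)"
proof (cases "x \<in> \<Union>\<B>")
  case True
  have bdd: "bdd_above ((\<lambda>R. measure lebesgue (E \<inter> R) / measure lebesgue R) ` {R\<in>\<B>. x \<in> R})"
    using assms(1) average_le_1[OF assms(2)] unfolding is_basis_def by (intro bdd_aboveI[of _ 1]) auto
  have ne: "{R\<in>\<B>. x \<in> R} \<noteq> {}" using True by auto
  have "max_op \<B> (indicator E) x = (SUP R\<in>{R\<in>\<B>. x \<in> R}. measure lebesgue (E \<inter> R) / measure lebesgue R)"
    unfolding max_op_def indicator_average using True by simp
  then have "\<beta> < max_op \<B> (indicator E) x \<longleftrightarrow>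
      (\<exists>R\<in>{R\<in>\<B>. x \<in> R}. \<beta> < measure lebesgue (E \<inter> R) / measure lebesgue R)"
    using less_cSUP_iff[OF ne bdd] by simp
  then show ?thesis by (auto simp: halo_def)
qed (use assms(3) in \<open>auto simp: halo_def max_op_def\<close>)

text \<open>Openness makes the inner halo measurable, so that \<open>mem_halo_iff\<close> applies to
  it in turn.\<close>

lemma open_halo:
  assumes "is_basis \<B>" "E \<in> sets lebesgue" "\<beta> \<ge> 0"
  shows "open (halo \<B> \<beta> E)"
proof -
  have "halo \<B> \<beta> E = \<Union>{R\<in>\<B>. \<beta> < measure lebesgue (E \<inter> R) / measure lebesgue R}"
    using mem_halo_iff[OF assms] by auto
  then show ?thesis using assms(1) by (auto simp: is_basis_def)
qed

lemma homothet_in_basis: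
  assumes "homothecy_invariant \<B>" "R \<in> \<B>" "t > 0"
  shows "homothet c t R \<in> \<B>"
proof -
  have "homothet c t R = (\<lambda>y. c + y) ` ((\<lambda>y. t *\<^sub>R y) ` R)" by (auto simp: homothet_def)
  then show ?thesis using assms by (simp add: homothecy_invariant_def)
qed

lemma halo_iterate:
  fixes \<B> :: "'a::euclidean_space set set"
  assumes \<B>: "is_basis \<B>" "homothecy_invariant \<B>" "\<forall>R\<in>\<B>. convex R"
    and \<alpha>: "0 < \<alpha>" and E: "E \<in> sets lebesgue" and \<eta>: "0 < \<eta>" "2 * \<eta> \<le> 1 - \<alpha>"
    and \<gamma>: "0 \<le> \<gamma>" "\<gamma> \<le> \<alpha> * (1 + \<eta> / (2 * 8 ^ DIM('a)))"
  shows "halo \<B> \<alpha> E \<subseteq> halo \<B> \<gamma> (halo \<B> (1 - 2 * \<eta>) E)"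
proof
  fix x assume "x \<in> halo \<B> \<alpha> E"
  then obtain R where xR: "R \<in> \<B>" "x \<in> R" and av: "\<alpha> < measure lebesgue (E \<inter> R) / measure lebesgue R"
    using mem_halo_iff[OF \<B>(1) E] \<alpha> by auto
  have R: "open R" "bounded R" "convex R" using \<B> xR(1) by (auto simp: is_basis_def)
  have pos: "measure lebesgue R > 0" using R xR by (intro measure_open_pos) auto
  define H where "H = halo \<B> (1 - 2 * \<eta>) E"
  have oH: "open H" unfolding H_def using \<B> E \<eta> \<alpha> by (intro open_halo) auto
  \<comment> \<open>The gap between \<eta> and 2\<eta> turns density at least 1 - \<eta> into the
    strict inequality that the halo at level 1 - 2\<eta> demands.\<close>
  have inH: "homothet c t R \<subseteq> H"
    if "t > 0" "measure lebesgue (E \<inter> homothet c t R) \<ge> (1 - \<eta>) * measure lebesgue (homothet c t R)" for c t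
  proof
    fix y assume y: "y \<in> homothet c t R"
    have "measure lebesgue (homothet c t R) > 0" using pos that(1) by (simp add: measure_homothet)
    then have "1 - \<eta> \<le> measure lebesgue (E \<inter> homothet c t R) / measure lebesgue (homothet c t R)"
      using that(2) by (simp add: field_simps)
    then have "1 - 2 * \<eta> < measure lebesgue (E \<inter> homothet c t R) / measure lebesgue (homothet c t R)"
      using \<eta> by simp
    then show "y \<in> H" unfolding H_def
      using mem_halo_iff[OF \<B>(1) E] y homothet_in_basis[OF \<B>(2) xR(1) that(1)] \<eta> \<alpha> by auto
  qed
  have "\<gamma> < measure lebesgue (H \<inter> R) / measure lebesgue R"
  proof (cases "measure lebesgue (E \<inter> R) \<le> (1 - \<eta>) * measure lebesgue R")
    case True
    define W where "W = \<Union>{homothet c t R |c t. t > 0 \<and> homothet c t R \<subseteq> R \<and>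
      measure lebesgue (E \<inter> homothet c t R) = (1 - \<eta>) * measure lebesgue (homothet c t R)}"
    have "homothet c t R \<subseteq> H" if "t > 0"
      "measure lebesgue (E \<inter> homothet c t R) = (1 - \<eta>) * measure lebesgue (homothet c t R)" for c t
      using inH[of t c] that by simp
    then have W: "W \<subseteq> H \<inter> R" unfolding W_def by blast
    have "open W" unfolding W_def using R by (auto intro!: open_homothet)
    let ?k = "1 + \<eta> / (2 * 8 ^ DIM('a))"
    have "?k > 0" using \<eta> by (simp add: add_pos_pos)
    have "\<gamma> * measure lebesgue R \<le> ?k * (\<alpha> * measure lebesgue R)"
      using \<gamma>(2) pos by (simp add: mult_right_mono mult.assoc[symmetric] mult.commute)
    also have "\<dots> < ?k * measure lebesgue (E \<inter> R)"
      using av pos \<open>?k > 0\<close> by (intro mult_strict_left_mono) (simp_all add: field_simps)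
    also have "\<dots> \<le> measure lebesgue W"
      unfolding W_def using homothets_gain[OF R E \<eta>(1) _ True] \<eta> \<alpha> by simp
    also have "\<dots> \<le> measure lebesgue (H \<inter> R)"
      by (rule measure_mono_fmeasurable)
        (use W \<open>open W\<close> oH R in \<open>auto intro!: lmeasurable_open bounded_Int\<close>)
    finally show ?thesis using pos by (simp add: field_simps)
  next
    case False
    then have "R \<subseteq> H" using inH[of 1 0] by (simp add: homothet_def)
    then have "H \<inter> R = R" by blast
    \<comment> \<open>Here H has density 1 in R, so \<gamma> < 1 suffices. It holds since \<gamma>
      \<le> \<alpha> + \<eta> and 0 < 2\<eta> \<le> 1 - \<alpha>.\<close>
    moreover have "\<gamma> < 1"
    proof -
      have "(1::real) \<le> 8 ^ DIM('a)" by simp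
      then have "1 \<le> 2 * (8::real) ^ DIM('a)" by linarith
      then have "\<eta> / (2 * 8 ^ DIM('a)) \<le> \<eta>"
        using \<eta>(1) by (simp add: divide_le_eq)
      then have "\<gamma> \<le> \<alpha> * (1 + \<eta>)" using \<gamma>(2) \<alpha> by (smt (verit) mult_left_mono)
      also have "\<dots> \<le> \<alpha> + \<eta>" using \<alpha> \<eta> by (simp add: algebra_simps mult_left_le)
      finally show ?thesis using \<eta> by simp
    qed
    ultimately show ?thesis using pos by simp
  qed
  then show "x \<in> halo \<B> \<gamma> (halo \<B> (1 - 2 * \<eta>) E)"
    using mem_halo_iff[OF \<B>(1) _ \<gamma>(1), of H] oH xR by (auto simp: H_def)
qed

theorem theorem4:
  "\<exists>c c'. c > 0 \<and> c' > 0 \<and>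
     (\<forall>(\<B>::'a::euclidean_space set set).
        is_basis \<B> \<and> homothecy_invariant \<B> \<and> (\<forall>R\<in>\<B>. convex R) \<longrightarrow>
        (\<forall>\<alpha> E \<delta>. 0 < \<alpha> \<and> \<alpha> < 1 \<and> E \<in> sets lebesgue \<and> emeasure lebesgue E < \<infinity> \<and>
           0 < \<delta> \<and> \<delta> \<le> c' * (1 - \<alpha>) \<longrightarrow>
           halo \<B> \<alpha> E \<subseteq>
             halo \<B> (\<alpha> * (1 + c * (min \<alpha> (1 - \<alpha>)) ^ (2 * DIM('a)) * \<delta>))
               (halo \<B> (1 - 3 * real DIM('a) powr (3 * real DIM('a) / 2) * \<delta>) E)))"
proof -
  define K where "K = 3 * real DIM('a) powr (3 * real DIM('a) / 2)"
  have K: "K > 0" by (simp add: K_def)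
  \<comment> \<open>For \<eta> = K\<delta>/2 the gain \<eta>/(2 * 8^n) is exactly c\<delta>. The
    other constant is 1/K, so that \<delta> \<le> (1 - \<alpha>)/K reads 2\<eta> \<le> 1 -
    \<alpha>.\<close>
  define c where "c = K / (4 * 8 ^ DIM('a))"
  have c: "c > 0" using K by (simp add: c_def)
  have main: "halo \<B> \<alpha> E \<subseteq>
      halo \<B> (\<alpha> * (1 + c * (min \<alpha> (1 - \<alpha>)) ^ (2 * DIM('a)) * \<delta>)) (halo \<B> (1 - K * \<delta>) E)"
    if \<B>: "is_basis \<B>" "homothecy_invariant \<B>" "\<forall>R\<in>\<B>. convex R"
      and \<alpha>: "0 < \<alpha>" "\<alpha> < 1" and E: "E \<in> sets lebesgue" and \<delta>: "0 < \<delta>" "\<delta> \<le> 1 / K * (1 - \<alpha>)"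
    for \<B> :: "'a set set" and \<alpha> E \<delta>
  proof -
    let ?p = "(min \<alpha> (1 - \<alpha>)) ^ (2 * DIM('a))"
    have p: "0 \<le> ?p" "?p \<le> 1" using \<alpha> by (auto intro!: power_le_one)
    \<comment> \<open>As \<open>?p\<close> is at most 1, the required level is at most \<alpha>(1 +
      c\<delta>), the level reached by \<open>halo_iterate\<close>.\<close>
    have "c * ?p * \<delta> \<le> c * 1 * \<delta>" using c \<delta> p by (intro mult_right_mono mult_left_mono) auto
    also have "c * 1 * \<delta> = (K * \<delta> / 2) / (2 * 8 ^ DIM('a))" by (simp add: c_def)
    finally have "\<alpha> * (1 + c * ?p * \<delta>) \<le> \<alpha> * (1 + (K * \<delta> / 2) / (2 * 8 ^ DIM('a)))"
      using \<alpha> by simp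
    moreover have "0 \<le> \<alpha> * (1 + c * ?p * \<delta>)" using \<alpha> c \<delta> p by simp
    moreover have "2 * (K * \<delta> / 2) \<le> 1 - \<alpha>" using \<delta> K by (simp add: field_simps)
    ultimately show ?thesis
      using halo_iterate[OF \<B> \<alpha>(1) E, of "K * \<delta> / 2"] K \<delta> by simp
  qed
  show ?thesis
    unfolding K_def[symmetric]
    by (rule exI[of _ c], rule exI[of _ "1 / K"]) (use c K main in auto)
qed

end
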